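(* Let $H$ be a Hilbert space and let $B:\overline{\mathbb{C}_+}\to\mathcal{L}(H)$ be an operator valued function which is holomorphic in $\mathbb{C}_+$ and such that for some constants $\alpha\ge 0$, $C>0$, $M\ge 0$ we have $$\|B(z)\|\le C(1+|z|)^M e^{\alpha\,\mathrm{Im}\, z},\qquad z\in\overline{\mathbb{C}_+}.$$ Assume that $I+B(z)$ is invertible with $(I+B(z))^{-1}\in\mathcal{L}(H)$ for $0<\mathrm{Im}\, z<1$, and that the image of $B(z)$ is contained in $V$ for all $z\in\overline{\mathbb{C}_+}$, where $V$ is a finite dimensional subspace of $H$ independent of $z$. Then for every $\epsilon>0$ there exists a constant $C_\epsilon>0$ such that $$\|(I+B(x+i/2))^{-1}\|\le C_\epsilon e^{\epsilon|x|^2},\qquad x\in\mathbb{R}.$$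
   Context: $\mathbb{C}_+=\{z\in\mathbb{C}:\mathrm{Im}\, z>0\}$ and $\overline{\mathbb{C}_+}=\{z\in\mathbb{C}:\mathrm{Im}\, z\ge 0\}$. $\mathcal{L}(H)$ denotes the space of bounded linear operators on the (complex) Hilbert space $H$, $\|\cdot\|$ the operator norm, and $I$ the identity operator on $H$. *)

theory Defs
  imports "HOL-Analysis.Analysis"
begin

class scaleC =
  fixes scaleC :: "complex \<Rightarrow> 'a \<Rightarrow> 'a"  (infixr "*\<^sub>C" 75)

class complex_vector = real_vector + scaleC +
  assumes scaleR_scaleC: "r *\<^sub>R x = complex_of_real r *\<^sub>C x"
    and scaleC_add_right: "c *\<^sub>C (x + y) = c *\<^sub>C x + c *\<^sub>C y"
    and scaleC_add_left: "(c + d) *\<^sub>C x = c *\<^sub>C x + d *\<^sub>C x"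
    and scaleC_scaleC: "c *\<^sub>C (d *\<^sub>C x) = (c * d) *\<^sub>C x"
    and scaleC_one: "1 *\<^sub>C x = x"

class complex_normed_vector = complex_vector + real_normed_vector +
  assumes norm_scaleC: "norm (c *\<^sub>C x) = cmod c * norm x"

text \<open>The inner product is linear in its first argument and conjugate-linear in its second.\<close>

class complex_inner = complex_vector + real_normed_vector +
  fixes cinner :: "'a \<Rightarrow> 'a \<Rightarrow> complex"
  assumes cinner_commute: "cinner x y = cnj (cinner y x)"
    and cinner_add_left: "cinner (x + y) z = cinner x z + cinner y z"
    and cinner_scaleC_left: "cinner (c *\<^sub>C x) y = c * cinner x y"
    and cinner_ge_zero: "0 \<le> Re (cinner x x)"
    and cinner_eq_zero_iff: "cinner x x = 0 \<longleftrightarrow> x = 0"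
    and norm_eq_sqrt_cinner: "norm x = sqrt (Re (cinner x x))"
begin

subclass complex_normed_vector
proof
  fix c :: complex and x :: 'a
  have "cinner (c *\<^sub>C x) (c *\<^sub>C x) = c * cnj c * cinner x x"
    using cinner_commute[of x "c *\<^sub>C x"] cinner_commute[of x x]
    by (simp add: cinner_scaleC_left mult_ac)
  then have "Re (cinner (c *\<^sub>C x) (c *\<^sub>C x)) = (cmod c)\<^sup>2 * Re (cinner x x)"
    by (simp add: complex_norm_square[symmetric])
  then show "norm (c *\<^sub>C x) = cmod c * norm x"
    by (simp add: norm_eq_sqrt_cinner real_sqrt_mult)
qed

end

class chilbert_space = complex_inner + complete_space
begin

subclass banach ..

end

instantiation complex :: chilbert_space
begin

definition "scaleC c (x::complex) = c * x"
definition "cinner x (y::complex) = x * cnj y"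

instance
  by standard
    (auto simp: scaleC_complex_def cinner_complex_def scaleR_conv_of_real algebra_simps
      cmod_def power2_eq_square)

end

global_interpretation complex_vector: vector_space "scaleC :: complex \<Rightarrow> 'a \<Rightarrow> 'a::complex_vector"
  defines csubspace = complex_vector.subspace
    and cspan = complex_vector.span
  by unfold_locales
    (simp_all add: scaleC_add_right scaleC_add_left scaleC_scaleC scaleC_one)

definition finite_dim_csubspace :: "'a::complex_vector set \<Rightarrow> bool"
  where "finite_dim_csubspace V \<longleftrightarrow> csubspace V \<and> (\<exists>b. finite b \<and> V = cspan b)"

definition bounded_clinear :: "('a::complex_normed_vector \<Rightarrow> 'b::complex_normed_vector) \<Rightarrow> bool"
  where "bounded_clinear f \<longleftrightarrow> bounded_linear f \<and> (\<forall>c x. f (c *\<^sub>C x) = c *\<^sub>C f x)"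

text \<open>The library's type of bounded operators consists of the real-linear ones; it carries the
  operator norm and, with the pointwise scalar multiplication below, is a complex normed space.
  The space \<open>\<L>(H)\<close> is the closed complex subspace of those \<open>A\<close> with
  \<open>bounded_clinear (blinfun_apply A)\<close>.\<close>

instantiation blinfun :: (real_normed_vector, complex_normed_vector) complex_normed_vector
begin

lift_definition scaleC_blinfun :: "complex \<Rightarrow> 'a \<Rightarrow>\<^sub>L 'b \<Rightarrow> 'a \<Rightarrow>\<^sub>L 'b"
  is "\<lambda>c f x. c *\<^sub>C f x"
proof -
  fix c :: complex and f :: "'a \<Rightarrow> 'b"
  assume f: "bounded_linear f"
  have "bounded_linear (\<lambda>x::'b. c *\<^sub>C x)"
    by (rule bounded_linear_intro[where K = "cmod c"])
      (simp_all add: scaleC_add_right scaleR_scaleC scaleC_scaleC norm_scaleC mult.commute)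
  from bounded_linear_compose[OF this f] show "bounded_linear (\<lambda>x. c *\<^sub>C f x)" .
qed

instance
proof
  fix c d :: complex and r :: real and f g :: "'a \<Rightarrow>\<^sub>L 'b"
  show "r *\<^sub>R f = complex_of_real r *\<^sub>C f"
    by transfer (simp add: scaleR_scaleC)
  show "c *\<^sub>C (f + g) = c *\<^sub>C f + c *\<^sub>C g"
    by transfer (simp add: scaleC_add_right)
  show "(c + d) *\<^sub>C f = c *\<^sub>C f + d *\<^sub>C f"
    by transfer (simp add: scaleC_add_left)
  show "c *\<^sub>C (d *\<^sub>C f) = (c * d) *\<^sub>C f"
    by transfer (simp add: scaleC_scaleC)
  show "1 *\<^sub>C f = f"
    by transfer (simp add: scaleC_one)
  have le: "norm (a *\<^sub>C h) \<le> cmod a * norm h" for a and h :: "'a \<Rightarrow>\<^sub>L 'b"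
    by (rule norm_blinfun_bound)
      (auto simp: scaleC_blinfun.rep_eq norm_scaleC mult.assoc intro!: mult_left_mono norm_blinfun)
  show "norm (c *\<^sub>C f) = cmod c * norm f"
  proof (cases "c = 0")
    case True
    then show ?thesis using le[of c f] by simp
  next
    case False
    have "inverse c *\<^sub>C (c *\<^sub>C f) = f"
      using False by transfer (simp add: scaleC_scaleC scaleC_one)
    with le[of "inverse c" "c *\<^sub>C f"] have "norm f \<le> norm (c *\<^sub>C f) / cmod c"
      by (simp add: norm_inverse divide_inverse mult.commute)
    with False have "cmod c * norm f \<le> norm (c *\<^sub>C f)"
      by (simp add: field_simps)
    with le[of c f] show ?thesis by simp
  qed
qed

end

text \<open>Holomorphy of vector-valued functions: existence of the complex derivative in norm (the
  library's \<open>holomorphic_on\<close> only covers functions with values in a field).\<close>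

definition vholomorphic_on :: "(complex \<Rightarrow> 'a::complex_normed_vector) \<Rightarrow> complex set \<Rightarrow> bool"
    (infixl "vholomorphic'_on" 50)
  where "f vholomorphic_on S \<longleftrightarrow>
    (\<forall>z\<in>S. \<exists>D. ((\<lambda>w. inverse (w - z) *\<^sub>C (f w - f z)) \<longlongrightarrow> D) (at z within S))"

definition boundedly_invertible :: "('a::complex_normed_vector \<Rightarrow>\<^sub>L 'a) \<Rightarrow> bool"
  where "boundedly_invertible A \<longleftrightarrow>
    bij (blinfun_apply A) \<and> bounded_clinear (inv (blinfun_apply A))"

text \<open>Only meaningful when \<open>boundedly_invertible A\<close>.\<close>

definition inverse_op :: "('a::complex_normed_vector \<Rightarrow>\<^sub>L 'a) \<Rightarrow> 'a \<Rightarrow>\<^sub>L 'a"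
  where "inverse_op A = Blinfun (inv (blinfun_apply A))"

end

theory Submission
  imports Defs "HOL-Complex_Analysis.Conformal_Mappings" "Jordan_Normal_Form.Determinant"
begin

text \<open>
  Since \<open>B z\<close> maps into the fixed finite-dimensional space \<open>V\<close>, invertibility of \<open>I + B z\<close> is
  governed by the determinant \<open>d z\<close> of its compression to \<open>V\<close>: by Cramer's rule the norm of
  \<open>(I + B z)\<^sup>-\<^sup>1\<close> is at most a polynomial in \<open>norm (B z)\<close> divided by \<open>cmod (d z)\<close>
  (\<open>detf_compression_bound\<close>). The function \<open>d\<close> is holomorphic in the upper half-plane, has no zero
  in the strip \<open>0 < Im z < 1\<close>, and satisfies a growth bound of the same kind as \<open>B\<close>. After division by
  a power of \<open>z + \<i>\<close> and an exponential it becomes a holomorphic function \<open>F\<close> with \<open>cmod (F z) \<le> 1\<close>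
  on the half-plane, and it remains to bound \<open>F\<close> from below on the line \<open>Im z = 1/2\<close>
  (\<open>nonvanishing_strip_lower_bound\<close>).

  For this lower bound, \<open>- ln (cmod (F z))\<close> is a nonnegative superharmonic function. If it exceeded
  \<open>\<epsilon> * x\<^sup>2\<close> at points \<open>x k + \<i> / 2\<close> with \<open>\<bar>x k\<bar>\<close> unbounded, then by Harnack's inequality, which applies because
  \<open>F\<close> has no zeros in the strip, it would be of size at least \<open>\<epsilon> * (x k)\<^sup>2 / 3\<close> on a disc of radius \<open>1/4\<close>
  about each of these points. The minimum principle then bounds it from below by a sum of Green's
  functions of the half-plane with poles \<open>x k + \<i> / 2\<close> and weights \<open>a * (x k)\<^sup>2\<close>. At \<open>\<i> / 2\<close> the
  Green's function with pole \<open>x k + \<i> / 2\<close> is comparable to \<open>1 / (x k)\<^sup>2\<close>, so each of the poles contributes a fixed positive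
  amount there; sufficiently many poles contradict \<open>F (\<i> / 2) \<noteq> 0\<close>. A sum of Green's functions with
  integer weights is minus the logarithm of the modulus of a finite Blaschke product, so the
  comparison is an instance of the maximum modulus principle (\<open>Blaschke_comparison\<close>).
\<close>

section \<open>Harnack's inequality and finite Blaschke products\<close>

text \<open>Harnack's inequality for the positive harmonic function \<open>Re g\<close> on a disc, at half the radius. It is the
  Schwarz lemma for \<open>g\<close> followed by the Cayley transform that sends the right half-plane to the unit
  disc and \<open>g w\<close> to the origin.\<close>

lemma Harnack_inequality_Re:
  assumes "g holomorphic_on ball w r" and "r > 0"
    and pos: "\<And>z. z \<in> ball w r \<Longrightarrow> Re (g z) > 0"
    and z: "dist w z \<le> r / 2"
  shows "Re (g w) \<le> 3 * Re (g z)"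
proof -
  have lt: "cmod (a - b) < cmod (a + cnj b)" if "Re a > 0" "Re b > 0" for a b
  proof -
    have "(cmod (a + cnj b))\<^sup>2 = (cmod (a - b))\<^sup>2 + 4 * Re a * Re b"
      unfolding cmod_power2 by (simp add: algebra_simps power2_eq_square)
    then have "(cmod (a - b))\<^sup>2 < (cmod (a + cnj b))\<^sup>2"
      using that by simp
    then show ?thesis
      by (rule power2_less_imp_less) simp
  qed
  define \<phi> where "\<phi> = (\<lambda>\<zeta>::complex. (g (w + r * \<zeta>) - g w) / (g (w + r * \<zeta>) + cnj (g w)))"
  have in_ball: "w + r * \<zeta> \<in> ball w r" if "cmod \<zeta> < 1" for \<zeta> :: complex
    using that \<open>r > 0\<close> by (simp add: dist_norm norm_mult)
  have w: "Re (g w) > 0"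
    using pos[of w] \<open>r > 0\<close> by simp
  have nz: "g (w + r * \<zeta>) + cnj (g w) \<noteq> 0" if "cmod \<zeta> < 1" for \<zeta> :: complex
    using lt[OF pos[OF in_ball[OF that]] w] by auto
  have "(g \<circ> (\<lambda>\<zeta>. w + r * \<zeta>)) holomorphic_on ball 0 1"
    by (rule holomorphic_on_compose_gen[OF _ assms(1)])
      (use in_ball in \<open>auto intro!: holomorphic_intros simp del: mem_ball\<close>)
  then have hol: "\<phi> holomorphic_on ball 0 1"
    unfolding \<phi>_def o_def using nz by (auto intro!: holomorphic_intros)
  have lt1: "cmod (\<phi> \<zeta>) < 1" if "cmod \<zeta> < 1" for \<zeta>
    using lt[OF pos[OF in_ball[OF that]] w] nz[OF that] unfolding \<phi>_def
    by (simp add: norm_divide)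
  define \<zeta> where "\<zeta> = (z - w) / r"
  have \<zeta>: "cmod \<zeta> \<le> 1/2" "w + r * \<zeta> = z"
    using z \<open>r > 0\<close> by (auto simp: \<zeta>_def norm_divide dist_norm norm_minus_commute field_simps)
  have "cmod (\<phi> \<zeta>) \<le> cmod \<zeta>"
    by (rule Schwarz_Lemma(1)[OF hol]) (use lt1 \<zeta> in \<open>auto simp: \<phi>_def\<close>)
  then have "cmod (\<phi> \<zeta>) \<le> 1/2"
    using \<zeta>(1) by linarith
  then have "cmod (g z - g w) / cmod (g z + cnj (g w)) \<le> 1/2"
    by (simp only: \<phi>_def norm_divide \<zeta>(2))
  then have "2 * cmod (g z - g w) \<le> cmod (g z + cnj (g w))"
    using nz[of \<zeta>] \<zeta> by (simp add: field_simps)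
  then have "(2 * cmod (g z - g w))\<^sup>2 \<le> (cmod (g z + cnj (g w)))\<^sup>2"
    by (intro power_mono) auto
  then have "4 * (Re (g w) - Re (g z))\<^sup>2 + 3 * (Im (g z) - Im (g w))\<^sup>2 \<le> (Re (g z) + Re (g w))\<^sup>2"
    by (simp add: power_mult_distrib cmod_power2 power2_commute[of "Re (g w)"])
  then have "4 * (Re (g w) - Re (g z))\<^sup>2 \<le> (Re (g z) + Re (g w))\<^sup>2"
    using zero_le_power2[of "Im (g z) - Im (g w)"] by linarith
  then have sq: "(2 * (Re (g w) - Re (g z)))\<^sup>2 \<le> (Re (g z) + Re (g w))\<^sup>2"
    unfolding power_mult_distrib by simp
  have "Re (g z) > 0"
    using pos[OF in_ball, of \<zeta>] \<zeta> by simp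
  then have "2 * (Re (g w) - Re (g z)) \<le> Re (g z) + Re (g w)"
    using w by (intro power2_le_imp_le[OF sq]) auto
  then show ?thesis by simp
qed

text \<open>Harnack's inequality for \<open>- ln (cmod (F z))\<close>, stated without logarithms.\<close>

lemma Harnack_inequality_norm:
  assumes hol: "F holomorphic_on ball w r" and "r > 0"
    and nz: "\<And>z. z \<in> ball w r \<Longrightarrow> F z \<noteq> 0"
    and le: "\<And>z. z \<in> ball w r \<Longrightarrow> cmod (F z) \<le> 1"
    and z: "dist w z \<le> r / 2"
  shows "cmod (F z) ^ 3 \<le> cmod (F w)"
proof -
  obtain g where g: "g holomorphic_on ball w r" "\<And>z. z \<in> ball w r \<Longrightarrow> exp (g z) = F z"
    using holomorphic_logarithm_exists[OF convex_ball open_ball hol nz, of w] \<open>r > 0\<close>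
    by (metis centre_in_ball)
  have norm_F: "cmod (F u) = exp (Re (g u))" if "u \<in> ball w r" for u
    using g(2)[OF that] by (metis norm_exp_eq_Re)
  have in_ball: "w \<in> ball w r" "z \<in> ball w r"
    using z \<open>r > 0\<close> by auto
  have "- Re (g w) \<le> 3 * (- Re (g z))"
  proof (rule field_le_epsilon)
    fix e :: real assume "e > 0"
    \<comment> \<open>The shift makes the real part strictly positive.\<close>
    have "Re (of_real (e / 2) - g w) \<le> 3 * Re (of_real (e / 2) - g z)"
    proof (rule Harnack_inequality_Re[OF _ \<open>r > 0\<close> _ z])
      show "(\<lambda>u. of_real (e / 2) - g u) holomorphic_on ball w r"
        by (intro holomorphic_intros g)
      fix u assume u: "u \<in> ball w r"
      show "Re (of_real (e / 2) - g u) > 0"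
        using le[OF u] norm_F[OF u] \<open>e > 0\<close> by simp
    qed
    then show "- Re (g w) \<le> 3 * (- Re (g z)) + e"
      by simp
  qed
  then have "exp (3 * Re (g z)) \<le> exp (Re (g w))"
    by simp
  then show ?thesis
    using in_ball by (simp add: norm_F exp_of_nat_mult[symmetric])
qed

text \<open>The squared modulus of the Blaschke factor \<open>(z - w) / (z - cnj w)\<close> of the upper half-plane is the
  inverse of \<open>1 + 4 * Im z * Im w / (cmod (z - w))\<^sup>2\<close>. Hence \<open>Q A\<close> below is the inverse squared modulus
  of a finite Blaschke product, and the lemma says that a bounded holomorphic function dominated by
  that product on circles of a common radius about its zeros is dominated by it everywhere outside the circles. No
  behaviour of \<open>F\<close> at the real line enters, because \<open>Q A\<close> tends to 1 there and at infinity.\<close>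

lemma Blaschke_comparison:
  fixes w :: "'i \<Rightarrow> complex" and s :: "'i \<Rightarrow> nat"
  defines "Q \<equiv> \<lambda>A z. \<Prod>k\<in>A. (1 + 4 * Im z * Im (w k) / (cmod (z - w k))\<^sup>2) ^ s k"
  assumes hol: "F holomorphic_on {z. Im z > 0}"
    and le: "\<And>z. Im z > 0 \<Longrightarrow> cmod (F z) \<le> 1"
    and A: "finite A" and w: "\<And>k. k \<in> A \<Longrightarrow> Im (w k) > 0" and "r > 0"
    and sph: "\<And>k z. k \<in> A \<Longrightarrow> Im z > 0 \<Longrightarrow> z \<in> sphere (w k) r \<Longrightarrow> (cmod (F z))\<^sup>2 * Q A z \<le> 1"
    and z: "Im z > 0" "\<And>k. k \<in> A \<Longrightarrow> z \<notin> ball (w k) r"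
  shows "(cmod (F z))\<^sup>2 * Q A z \<le> 1"
proof -
  define G where "G = (\<lambda>z. F z * (\<Prod>k\<in>A. ((z - cnj (w k)) / (z - w k)) ^ s k))"
  \<comment> \<open>The open discs to be excluded from the domain.\<close>
  define O' where "O' = (\<Union>k\<in>A. ball (w k) r)"
  have norm_G: "(cmod (G z))\<^sup>2 = (cmod (F z))\<^sup>2 * Q A z" if "z \<notin> O'" for z
  proof -
    have "(cmod (((z - cnj (w k)) / (z - w k)) ^ s k))\<^sup>2
        = (1 + 4 * Im z * Im (w k) / (cmod (z - w k))\<^sup>2) ^ s k" if "k \<in> A" for k
    proof -
      have "z \<noteq> w k"
        using that \<open>z \<notin> O'\<close> \<open>r > 0\<close> by (auto simp: O'_def)
      moreover have "(cmod (z - cnj (w k)))\<^sup>2 = (cmod (z - w k))\<^sup>2 + 4 * Im z * Im (w k)"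
        unfolding cmod_power2 by (simp add: algebra_simps power2_eq_square)
      ultimately have "(cmod ((z - cnj (w k)) / (z - w k)))\<^sup>2
          = 1 + 4 * Im z * Im (w k) / (cmod (z - w k))\<^sup>2"
        by (simp add: norm_divide power_divide add_divide_distrib)
      then show ?thesis
        by (metis norm_power power_mult mult.commute)
    qed
    then show ?thesis
      by (simp add: G_def Q_def norm_mult prod_norm[symmetric] power_mult_distrib
          prod_power_distrib del: norm_power)
  qed
  have bound: "(cmod (G z))\<^sup>2 \<le> (1 + \<eta>) ^ sum s A" if "\<eta> > 0" for \<eta> :: real
  proof -
    \<comment> \<open>A finite union of closed hyperbolic discs in the open half-plane.\<close>
    define S where "S = (\<Union>k\<in>A. {z. \<eta> * (cmod (z - w k))\<^sup>2 \<le> 4 * Im z * Im (w k)})"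
    have closed_S: "closed S"
      unfolding S_def using A
      by (intro closed_UN ballI closed_Collect_le continuous_intros)
    have S_pos: "Im u > 0" if uS: "u \<in> S" for u
    proof (rule ccontr)
      assume neg: "\<not> Im u > 0"
      obtain k where k: "k \<in> A" "\<eta> * (cmod (u - w k))\<^sup>2 \<le> 4 * Im u * Im (w k)"
        using uS unfolding S_def by blast
      have "4 * Im u * Im (w k) \<le> 0"
        using neg w[OF k(1)] by (simp add: mult_nonpos_nonneg)
      then have "(cmod (u - w k))\<^sup>2 \<le> 0"
        using k(2) \<open>\<eta> > 0\<close> by (meson order_trans zero_less_mult_iff not_le)
      then have "u = w k" by simp
      then show False using neg w[OF k(1)] by simp
    qed
    have bounded_S: "bounded S"
      unfolding S_def
    proof (rule bounded_UN[OF A], rule ballI)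
      fix k assume "k \<in> A"
      have "dist (w k) u \<le> 4 * Im (w k) / \<eta> + Im (w k)"
        if u: "\<eta> * (cmod (u - w k))\<^sup>2 \<le> 4 * Im u * Im (w k)" for u
      proof (rule ccontr)
        define d where "d = cmod (u - w k)"
        assume "\<not> dist (w k) u \<le> 4 * Im (w k) / \<eta> + Im (w k)"
        then have d: "d > 4 * Im (w k) / \<eta> + Im (w k)"
          by (simp add: d_def dist_norm norm_minus_commute)
        have wk: "Im (w k) > 0" "4 * Im (w k) / \<eta> > 0"
          using w[OF \<open>k \<in> A\<close>] \<open>\<eta> > 0\<close> by auto
        have "Im u \<le> d + Im (w k)"
          using abs_Im_le_cmod[of "u - w k"] by (simp add: d_def)
        then have "\<eta> * d\<^sup>2 \<le> 4 * (d + Im (w k)) * Im (w k)"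
          using u wk unfolding d_def by (intro order_trans[OF u] mult_right_mono mult_left_mono) simp_all
        also have "\<dots> = \<eta> * (4 * Im (w k) / \<eta>) * (d + Im (w k))"
          using \<open>\<eta> > 0\<close> by simp
        also have "\<dots> < \<eta> * (d - Im (w k)) * (d + Im (w k))"
        proof -
          have "4 * Im (w k) / \<eta> < d - Im (w k)" "0 < d + Im (w k)"
            using d wk by linarith+
          then show ?thesis
            using \<open>\<eta> > 0\<close> by (intro mult_strict_right_mono mult_strict_left_mono) auto
        qed
        also have "\<dots> = \<eta> * d\<^sup>2 - \<eta> * (Im (w k))\<^sup>2"
          by (simp add: algebra_simps power2_eq_square)
        also have "\<dots> \<le> \<eta> * d\<^sup>2"
          using \<open>\<eta> > 0\<close> by simp
        finally show False by simp
      qed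
      then show "bounded {u. \<eta> * (cmod (u - w k))\<^sup>2 \<le> 4 * Im u * Im (w k)}"
        unfolding bounded_def by blast
    qed
    \<comment> \<open>Off the interior of \<open>S\<close> the factors of \<open>Q A\<close> are at most powers of \<open>1 + \<eta>\<close>.\<close>
    have outside: "(cmod (G u))\<^sup>2 \<le> (1 + \<eta>) ^ sum s A"
      if u: "Im u > 0" "u \<notin> interior S" "u \<notin> O'" for u
    proof -
      have "Q A u \<le> (\<Prod>k\<in>A. (1 + \<eta>) ^ s k)"
        unfolding Q_def
      proof (rule prod_mono, intro conjI)
        fix k assume k: "k \<in> A"
        have "u \<noteq> w k"
          using k u(3) \<open>r > 0\<close> by (auto simp: O'_def)
        have "4 * Im u * Im (w k) \<le> \<eta> * (cmod (u - w k))\<^sup>2"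
        proof (rule ccontr)
          assume "\<not> ?thesis"
          moreover have "open {z. \<eta> * (cmod (z - w k))\<^sup>2 < 4 * Im z * Im (w k)}"
            by (intro open_Collect_less continuous_intros)
          moreover have "{z. \<eta> * (cmod (z - w k))\<^sup>2 < 4 * Im z * Im (w k)} \<subseteq> S"
            using k by (auto simp: S_def intro: less_imp_le)
          ultimately show False
            using u(2) interior_maximal[of "{z. \<eta> * (cmod (z - w k))\<^sup>2 < 4 * Im z * Im (w k)}" S]
          by (auto simp: not_le)
        qed
        then have "4 * Im u * Im (w k) / (cmod (u - w k))\<^sup>2 \<le> \<eta>"
          using \<open>u \<noteq> w k\<close> by (simp add: field_simps)
        moreover have "0 \<le> 4 * Im u * Im (w k) / (cmod (u - w k))\<^sup>2"
          using u w[OF k] by simp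
        ultimately show "0 \<le> (1 + 4 * Im u * Im (w k) / (cmod (u - w k))\<^sup>2) ^ s k"
          "(1 + 4 * Im u * Im (w k) / (cmod (u - w k))\<^sup>2) ^ s k \<le> (1 + \<eta>) ^ s k"
          by (auto intro!: power_mono zero_le_power)
      qed
      moreover have "(cmod (F u))\<^sup>2 \<le> 1"
        using le[OF u(1)] by (simp add: power_le_one)
      moreover have Q_nonneg: "0 \<le> Q A u"
        unfolding Q_def by (intro prod_nonneg zero_le_power) (simp add: u(1) w less_imp_le)
      ultimately have "(cmod (F u))\<^sup>2 * Q A u \<le> 1 * (\<Prod>k\<in>A. (1 + \<eta>) ^ s k)"
        using Q_nonneg by (intro mult_mono') auto
      then show ?thesis
        using norm_G[OF u(3)] by (simp add: power_sum)
    qed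
    have open_O: "open O'" by (auto simp: O'_def)
    have zO: "z \<notin> O'" using z(2) by (auto simp: O'_def)
    show ?thesis
    proof (cases "z \<in> S")
      case False
      then show ?thesis
        using outside[OF z(1) _ zO] interior_subset by blast
    next
      case True
      define T where "T = S - O'"
      have closed_T: "closed T"
        using closed_S open_O by (auto simp: T_def)
      have G_hol: "G holomorphic_on T"
        unfolding G_def
      proof (intro holomorphic_intros holomorphic_on_subset[OF hol])
        show "T \<subseteq> {z. Im z > 0}" using S_pos by (auto simp: T_def)
        fix k u assume "k \<in> A" "u \<in> T"
        then show "u - w k \<noteq> 0" using \<open>r > 0\<close> by (auto simp: T_def O'_def)
      qed
      have "cmod (G z) \<le> sqrt ((1 + \<eta>) ^ sum s A)"
      proof (rule maximum_modulus_frontier[where f = G and S = T])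
        show "G holomorphic_on interior T"
          using G_hol holomorphic_on_subset interior_subset by blast
        show "continuous_on (closure T) G"
          using G_hol closed_T by (simp add: holomorphic_on_imp_continuous_on)
        show "bounded T"
          using bounded_S by (auto simp: T_def bounded_diff)
        show "z \<in> T"
          using True zO by (simp add: T_def)
        fix u assume u: "u \<in> frontier T"
        then have uT: "u \<in> T" "u \<notin> interior T"
          using closed_T by (auto simp: frontier_def)
        then have uO: "u \<notin> O'" and uS: "Im u > 0"
          using S_pos by (auto simp: T_def)
        have "(cmod (G u))\<^sup>2 \<le> (1 + \<eta>) ^ sum s A"
        proof (cases "\<exists>k\<in>A. u \<in> sphere (w k) r")
          case True
          then have "(cmod (G u))\<^sup>2 \<le> 1"
            using sph uS norm_G[OF uO] by auto
          also have "1 \<le> (1 + \<eta>) ^ sum s A"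
            using \<open>\<eta> > 0\<close> by simp
          finally show ?thesis .
        next
          case False
          then have "u \<in> - (\<Union>k\<in>A. cball (w k) r)"
            using uO by (force simp: O'_def)
          moreover have "open (- (\<Union>k\<in>A. cball (w k) r))"
            using A by (auto intro!: closed_UN)
          moreover have "interior S \<inter> - (\<Union>k\<in>A. cball (w k) r) \<subseteq> T"
            using interior_subset[of S] by (force simp: T_def O'_def)
          ultimately have "u \<notin> interior S"
            using uT(2) interior_maximal[of "interior S \<inter> - (\<Union>k\<in>A. cball (w k) r)" T]
            by blast
          then show ?thesis
            using outside uO uS by blast
        qed
        then show "cmod (G u) \<le> sqrt ((1 + \<eta>) ^ sum s A)"
          by (rule real_le_rsqrt)
      qed
      then show ?thesis
        using power_mono[of "cmod (G z)" _ 2] \<open>\<eta> > 0\<close> by fastforce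
    qed
  qed
  have "((\<lambda>\<eta>::real. (1 + \<eta>) ^ sum s A) \<longlongrightarrow> (1 + 0) ^ sum s A) (at_right 0)"
    by (intro tendsto_intros)
  moreover have "\<forall>\<^sub>F \<eta> in at_right 0. (cmod (G z))\<^sup>2 \<le> (1 + \<eta>) ^ sum s A"
    by (rule eventually_at_rightI[of 0 1]) (auto intro: bound)
  ultimately have "(cmod (G z))\<^sup>2 \<le> (1 + 0) ^ sum s A"
    by (rule tendsto_lowerbound) simp
  then show ?thesis
    using norm_G[of z] z(2) by (auto simp: O'_def)
qed

section \<open>Lower bounds on a line in a zero-free strip\<close>

lemma sparse_sequence_exists:
  fixes P :: "real \<Rightarrow> bool"
  assumes unb: "\<And>L. \<exists>x. L \<le> \<bar>x\<bar> \<and> P x"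
  obtains x :: "nat \<Rightarrow> real" where "\<And>n. P (x n)" "\<And>n. L \<le> \<bar>x n\<bar>"
    "\<And>j k. j < k \<Longrightarrow> 2 * \<bar>x j\<bar> \<le> \<bar>x k\<bar>"
proof -
  have "\<exists>x::nat \<Rightarrow> real. \<forall>n. (P (x n) \<and> L \<le> \<bar>x n\<bar>) \<and> 2 * \<bar>x n\<bar> \<le> \<bar>x (Suc n)\<bar>"
  proof (rule dependent_nat_choice)
    show "\<exists>x. P x \<and> L \<le> \<bar>x\<bar>" using unb by blast
    fix x :: real
    show "\<exists>y. (P y \<and> L \<le> \<bar>y\<bar>) \<and> 2 * \<bar>x\<bar> \<le> \<bar>y\<bar>"
      using unb[of "max L (2 * \<bar>x\<bar>)"] by auto
  qed
  then obtain x :: "nat \<Rightarrow> real"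
    where x: "\<And>n. P (x n) \<and> L \<le> \<bar>x n\<bar>" "\<And>n. 2 * \<bar>x n\<bar> \<le> \<bar>x (Suc n)\<bar>"
    by blast
  have inc: "\<bar>x n\<bar> \<le> \<bar>x (Suc n)\<bar>" for n
    using x(2)[of n] by linarith
  have sparse: "2 * \<bar>x j\<bar> \<le> \<bar>x k\<bar>" if "j < k" for j k
    using x(2)[of j] lift_Suc_mono_le[of "\<lambda>n. \<bar>x n\<bar>", OF inc Suc_leI[OF that]] by linarith
  show thesis
    by (rule that[of x]) (use x(1) sparse in blast)+
qed

text \<open>A function bounded by 1 on the upper half-plane and without zeros in the strip \<open>0 < Im z < 1\<close> decays
  on the line \<open>Im z = 1/2\<close> more slowly than every Gaussian. Without the half-plane bound this would fail: in
  the strip alone, double exponential decay is possible.\<close>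

lemma nonvanishing_strip_lower_bound:
  assumes hol: "F holomorphic_on {z. Im z > 0}"
    and le: "\<And>z. Im z > 0 \<Longrightarrow> cmod (F z) \<le> 1"
    and nz: "\<And>z. 0 < Im z \<Longrightarrow> Im z < 1 \<Longrightarrow> F z \<noteq> 0"
    and "\<epsilon> > 0"
  shows "\<exists>c>0. \<forall>x::real. c * exp (- (\<epsilon> * x\<^sup>2)) \<le> cmod (F (complex_of_real x + \<i> / 2))"
proof (rule ccontr)
  assume no_bound: "\<not> ?thesis"
  define P where "P = (\<lambda>x::real. cmod (F (complex_of_real x + \<i> / 2)) < exp (- (\<epsilon> * x\<^sup>2)))"
  \<comment> \<open>On a compact part of the line \<open>F\<close> is bounded away from zero, so the violations escape to infinity.\<close>
  have unb: "\<exists>x. L \<le> \<bar>x\<bar> \<and> P x" for L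
  proof (rule ccontr)
    assume "\<not> ?thesis"
    then have large: "exp (- (\<epsilon> * x\<^sup>2)) \<le> cmod (F (complex_of_real x + \<i> / 2))" if "L \<le> \<bar>x\<bar>" for x
      using that by (auto simp: P_def not_less)
    have "continuous_on {-\<bar>L\<bar>..\<bar>L\<bar>} (\<lambda>x. cmod (F (complex_of_real x + \<i> / 2)))"
      by (intro continuous_on_norm continuous_on_compose2[OF holomorphic_on_imp_continuous_on[OF hol]]
          continuous_intros) auto
    moreover have "{-\<bar>L\<bar>..\<bar>L\<bar>} \<noteq> {}" by simp
    ultimately obtain x0 where x0: "\<forall>x\<in>{-\<bar>L\<bar>..\<bar>L\<bar>}.
        cmod (F (complex_of_real x0 + \<i> / 2)) \<le> cmod (F (complex_of_real x + \<i> / 2))"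
      using continuous_attains_inf[OF compact_Icc] by blast
    define c where "c = min 1 (cmod (F (complex_of_real x0 + \<i> / 2)))"
    have "c > 0" using nz[of "complex_of_real x0 + \<i> / 2"] by (simp add: c_def)
    moreover have "c * exp (- (\<epsilon> * x\<^sup>2)) \<le> cmod (F (complex_of_real x + \<i> / 2))" for x :: real
    proof (cases "L \<le> \<bar>x\<bar>")
      case True
      have "c * exp (- (\<epsilon> * x\<^sup>2)) \<le> 1 * exp (- (\<epsilon> * x\<^sup>2))"
        by (intro mult_right_mono) (auto simp: c_def)
      with large[OF True] show ?thesis by linarith
    next
      case False
      then have "x \<in> {-\<bar>L\<bar>..\<bar>L\<bar>}" by auto
      then have "c \<le> cmod (F (complex_of_real x + \<i> / 2))"
        using x0 unfolding c_def by (intro min.coboundedI2) blast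
      moreover have "c * exp (- (\<epsilon> * x\<^sup>2)) \<le> c * 1"
        using \<open>c > 0\<close> \<open>\<epsilon> > 0\<close> by (intro mult_left_mono) auto
      ultimately show ?thesis by linarith
    qed
    ultimately show False using no_bound by blast
  qed
  \<comment> \<open>The multiplicity of the Blaschke zero at \<open>w k\<close> is about \<open>a * (x k)\<^sup>2\<close>; the constant is small enough for
      the bounds \<open>own\<close> and \<open>other\<close> below to be absorbed by the smallness of \<open>F\<close>.\<close>
  define a where "a = \<epsilon> / 12"
  have "a > 0" using \<open>\<epsilon> > 0\<close> by (simp add: a_def)
  define F0 where "F0 = (cmod (F (\<i> / 2)))\<^sup>2"
  have "F0 > 0" using nz[of "\<i> / 2"] by (simp add: F0_def)
  obtain K :: nat where K: "1 / F0 < (1 + a / 2) ^ K"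
    using real_arch_pow[of "1 + a / 2" "1 / F0"] \<open>a > 0\<close> by auto
  \<comment> \<open>The number \<open>K\<close> of points is fixed first, so that all points can be taken large compared with it.\<close>
  define L where "L = max 1 (max (6 * real K) (1 / a))"
  obtain x :: "nat \<Rightarrow> real" where xP: "\<And>n. P (x n)" and xL: "\<And>n. L \<le> \<bar>x n\<bar>"
    and sparse: "\<And>j k. j < k \<Longrightarrow> 2 * \<bar>x j\<bar> \<le> \<bar>x k\<bar>"
    by (rule sparse_sequence_exists[OF unb]) blast
  have x1: "1 \<le> \<bar>x n\<bar>" for n
    using xL[of n] by (simp add: L_def)
  have xsq: "\<bar>x n\<bar> \<le> (x n)\<^sup>2" for n
    using self_le_power[OF x1, of 2 n] by simp
  have xK: "6 * real K \<le> (x n)\<^sup>2" and xa: "1 \<le> a * (x n)\<^sup>2" for n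
  proof -
    show "6 * real K \<le> (x n)\<^sup>2" using xL[of n] xsq[of n] by (simp add: L_def)
    have "1 / a \<le> (x n)\<^sup>2" using xL[of n] xsq[of n] by (simp add: L_def)
    then show "1 \<le> a * (x n)\<^sup>2" using \<open>a > 0\<close> by (simp add: field_simps)
  qed
  have sep: "\<bar>x j\<bar> / 2 \<le> \<bar>x k - x j\<bar>" if "j \<noteq> k" for j k
  proof -
    have "2 * \<bar>x j\<bar> \<le> \<bar>x k\<bar> \<or> 2 * \<bar>x k\<bar> \<le> \<bar>x j\<bar>"
      using sparse[of j k] sparse[of k j] that by (meson nat_neq_iff)
    then show ?thesis by linarith
  qed
  define w where "w = (\<lambda>k. complex_of_real (x k) + \<i> / 2)"
  have Im_w: "Im (w k) = 1 / 2" for k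
    by (simp add: w_def)
  define s where "s = (\<lambda>k. nat \<lfloor>a * (x k)\<^sup>2\<rfloor>)"
  have s_le: "real (s k) \<le> a * (x k)\<^sup>2" and s_ge: "a * (x k)\<^sup>2 / 2 \<le> real (s k)" for k
  proof -
    have "1 \<le> \<lfloor>a * (x k)\<^sup>2\<rfloor>"
      using xa[of k] by (simp add: le_floor_iff)
    then have "real (s k) = of_int \<lfloor>a * (x k)\<^sup>2\<rfloor>" "(1::real) \<le> of_int \<lfloor>a * (x k)\<^sup>2\<rfloor>"
      by (auto simp: s_def)
    then show "real (s k) \<le> a * (x k)\<^sup>2" "a * (x k)\<^sup>2 / 2 \<le> real (s k)"
      using floor_correct[of "a * (x k)\<^sup>2"] by linarith+
  qed
  define Q where "Q = (\<lambda>z. \<Prod>k<K. (1 + 4 * Im z * Im (w k) / (cmod (z - w k))\<^sup>2) ^ s k)"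
  have "(cmod (F (\<i> / 2)))\<^sup>2 * Q (\<i> / 2) \<le> 1"
    unfolding Q_def
  proof (rule Blaschke_comparison[OF hol le, where r = "1 / 4"])
    fix k assume "k \<in> {..<K}"
    show "\<i> / 2 \<notin> ball (w k) (1 / 4)"
      using x1[of k] by (simp add: w_def dist_norm)
  next
    fix k z assume k: "k \<in> {..<K}" and z: "Im z > 0" "z \<in> sphere (w k) (1 / 4)"
    have wz: "dist (w k) z = 1 / 4" "cmod (z - w k) = 1 / 4"
      using z(2) by (auto simp: dist_norm norm_minus_commute)
    have Im_ball: "0 < Im u \<and> Im u < 1" if "u \<in> ball (w k) (1 / 2)" for u
      using that abs_Im_le_cmod[of "w k - u"] by (auto simp: dist_norm w_def)
    have "cmod (F z) ^ 3 \<le> cmod (F (w k))"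
    proof (rule Harnack_inequality_norm[where F = F and w = "w k" and r = "1 / 2"])
      show "F holomorphic_on ball (w k) (1 / 2)"
        using Im_ball by (intro holomorphic_on_subset[OF hol]) blast
      show "dist (w k) z \<le> 1 / 2 / 2"
        using wz by simp
      fix u assume u: "u \<in> ball (w k) (1 / 2)"
      show "F u \<noteq> 0" "cmod (F u) \<le> 1"
        using Im_ball[OF u] nz le by blast+
    qed simp
    also have "\<dots> \<le> exp (- (\<epsilon> * (x k)\<^sup>2 / 3)) ^ 3"
      using xP[of k] by (simp add: P_def w_def exp_of_nat_mult[symmetric])
    finally have "cmod (F z) \<le> exp (- (\<epsilon> * (x k)\<^sup>2 / 3))"
      using power_le_imp_le_base[of "cmod (F z)" 2] by (simp add: numeral_3_eq_3)
    then have F_le: "(cmod (F z))\<^sup>2 \<le> exp (- (\<epsilon> * (x k)\<^sup>2 / 3)) ^ 2"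
      by (rule power_mono) simp
    have Im_z: "2 * Im z \<le> 3 / 2"
      using abs_Im_le_cmod[of "z - w k"] wz by (simp add: w_def)
    \<comment> \<open>The zero at \<open>w k\<close> itself: on its circle the base of the power is at most 25.\<close>
    have own: "(1 + 4 * Im z * Im (w k) / (cmod (z - w k))\<^sup>2) ^ s k \<le> exp (4 * a * (x k)\<^sup>2)"
    proof -
      have "(5/2::real) \<le> exp 1"
        using exp_lower_Taylor_quadratic[of 1] by simp
      then have "(5/2) ^ 4 \<le> exp (1::real) ^ 4"
        by (intro power_mono) auto
      then have "25 \<le> exp (4::real)"
        by (simp add: exp_of_nat_mult[symmetric] power_divide)
      then have "1 + 4 * Im z * Im (w k) / (cmod (z - w k))\<^sup>2 \<le> exp 4"
        using Im_z by (simp add: wz(2) Im_w power_divide)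
      then have "(1 + 4 * Im z * Im (w k) / (cmod (z - w k))\<^sup>2) ^ s k \<le> exp 4 ^ s k"
        using z(1) by (intro power_mono) (auto simp: w_def)
      also have "\<dots> = exp (4 * real (s k))"
        by (simp add: exp_of_nat_mult[symmetric] mult.commute)
      also have "\<dots> \<le> exp (4 * a * (x k)\<^sup>2)"
        using s_le[of k] by simp
      finally show ?thesis .
    qed
    \<comment> \<open>The other zeros: by sparsity each of them contributes a bounded amount only.\<close>
    have other: "(1 + 4 * Im z * Im (w j) / (cmod (z - w j))\<^sup>2) ^ s j \<le> exp (24 * a)" if "j \<noteq> k" for j
    proof -
      have "\<bar>x k - x j\<bar> \<le> cmod (z - w j) + 1 / 4"
        using abs_Re_le_cmod[of "z - w j"] abs_Re_le_cmod[of "z - w k"] wz by (simp add: w_def)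
      then have "\<bar>x j\<bar> / 4 \<le> cmod (z - w j)"
        using sep[OF that] x1[of j] by linarith
      then have "(\<bar>x j\<bar> / 4)\<^sup>2 \<le> (cmod (z - w j))\<^sup>2"
        by (intro power_mono) auto
      then have d: "(x j)\<^sup>2 / 16 \<le> (cmod (z - w j))\<^sup>2"
        by (simp add: power_divide)
      have xj: "(x j)\<^sup>2 > 0" using x1[of j] by auto
      have "4 * Im z * Im (w j) / (cmod (z - w j))\<^sup>2 \<le> (3 / 2) / ((x j)\<^sup>2 / 16)"
        using d Im_z z(1) xj by (intro frac_le) (auto simp: w_def)
      then have "1 + 4 * Im z * Im (w j) / (cmod (z - w j))\<^sup>2 \<le> 1 + 24 / (x j)\<^sup>2"
        by simp
      also have "\<dots> \<le> exp (24 / (x j)\<^sup>2)"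
        by (rule exp_ge_add_one_self)
      finally have "(1 + 4 * Im z * Im (w j) / (cmod (z - w j))\<^sup>2) ^ s j \<le> exp (24 / (x j)\<^sup>2) ^ s j"
        using z(1) by (intro power_mono) (auto simp: w_def)
      also have "\<dots> = exp (real (s j) * (24 / (x j)\<^sup>2))"
        by (rule exp_of_nat_mult[symmetric])
      also have "real (s j) * (24 / (x j)\<^sup>2) \<le> (a * (x j)\<^sup>2) * (24 / (x j)\<^sup>2)"
        using s_le[of j] xj by (intro mult_right_mono) auto
      also have "\<dots> = 24 * a" using xj by simp
      finally show ?thesis by simp
    qed
    have "Q z = (1 + 4 * Im z * Im (w k) / (cmod (z - w k))\<^sup>2) ^ s k
        * (\<Prod>j\<in>{..<K} - {k}. (1 + 4 * Im z * Im (w j) / (cmod (z - w j))\<^sup>2) ^ s j)"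
      unfolding Q_def using k by (intro prod.remove) auto
    also have "\<dots> \<le> exp (4 * a * (x k)\<^sup>2) * (\<Prod>j\<in>{..<K} - {k}. exp (24 * a))"
    proof (rule mult_mono)
      show "(\<Prod>j\<in>{..<K} - {k}. (1 + 4 * Im z * Im (w j) / (cmod (z - w j))\<^sup>2) ^ s j)
          \<le> (\<Prod>j\<in>{..<K} - {k}. exp (24 * a))"
        using z(1) other by (intro prod_mono) (auto simp: w_def)
      show "0 \<le> (\<Prod>j\<in>{..<K} - {k}. (1 + 4 * Im z * Im (w j) / (cmod (z - w j))\<^sup>2) ^ s j)"
        using z(1) by (intro prod_nonneg) (auto simp: w_def)
    qed (use own in auto)
    also have "(\<Prod>j\<in>{..<K} - {k}. exp (24 * a)) \<le> exp (24 * a) ^ K"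
    proof -
      have "card ({..<K} - {k}) \<le> K"
        using card_mono[of "{..<K}" "{..<K} - {k}"] by auto
      then have "exp (24 * a) ^ card ({..<K} - {k}) \<le> exp (24 * a) ^ K"
        using \<open>a > 0\<close> by (intro power_increasing) auto
      then show ?thesis by simp
    qed
    also have "exp (4 * a * (x k)\<^sup>2) * exp (24 * a) ^ K = exp (4 * a * (x k)\<^sup>2 + 4 * a * (6 * real K))"
      by (simp add: exp_add exp_of_nat_mult[symmetric] algebra_simps)
    also have "\<dots> \<le> exp (4 * a * (x k)\<^sup>2 + 4 * a * (x k)\<^sup>2)"
      using xK[of k] \<open>a > 0\<close> by simp
    also have "\<dots> = exp (\<epsilon> * (x k)\<^sup>2 / 3) ^ 2"
      by (simp add: a_def exp_of_nat_mult[symmetric])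
    finally have Q_le: "Q z \<le> exp (\<epsilon> * (x k)\<^sup>2 / 3) ^ 2" by simp
    have "0 \<le> Q z"
      unfolding Q_def using z(1) by (intro prod_nonneg) (auto simp: w_def)
    then have "(cmod (F z))\<^sup>2 * Q z \<le> exp (- (\<epsilon> * (x k)\<^sup>2 / 3)) ^ 2 * exp (\<epsilon> * (x k)\<^sup>2 / 3) ^ 2"
      using F_le Q_le by (intro mult_mono) auto
    also have "\<dots> = 1"
      by (simp add: power_mult_distrib[symmetric] exp_add[symmetric])
    finally show "(cmod (F z))\<^sup>2 * (\<Prod>k<K. (1 + 4 * Im z * Im (w k) / (cmod (z - w k))\<^sup>2) ^ s k) \<le> 1"
      unfolding Q_def .
  qed (auto simp: w_def)
  \<comment> \<open>At \<open>\<i> / 2\<close> each zero contributes at least the fixed factor \<open>1 + a / 2\<close>.\<close>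
  moreover have "(1 + a / 2) ^ K \<le> Q (\<i> / 2)"
  proof -
    have "1 + a / 2 \<le> (1 + 4 * Im (\<i> / 2) * Im (w k) / (cmod (\<i> / 2 - w k))\<^sup>2) ^ s k" for k
    proof -
      have xk: "(x k)\<^sup>2 > 0" using x1[of k] by auto
      have "a / 2 = (a * (x k)\<^sup>2 / 2) * (1 / (x k)\<^sup>2)"
        using xk by simp
      also have "\<dots> \<le> real (s k) * (1 / (x k)\<^sup>2)"
        using s_ge[of k] xk by (intro mult_right_mono) auto
      also have "1 + \<dots> \<le> (1 + 1 / (x k)\<^sup>2) ^ s k"
      proof (rule Bernoulli_inequality)
        have "0 \<le> 1 / (x k)\<^sup>2" by simp
        then show "-1 \<le> 1 / (x k)\<^sup>2" by linarith
      qed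
      also have "1 / (x k)\<^sup>2 = 4 * Im (\<i> / 2) * Im (w k) / (cmod (\<i> / 2 - w k))\<^sup>2"
        by (simp add: w_def)
      finally show ?thesis by simp
    qed
    then have "(\<Prod>k<K. 1 + a / 2) \<le> Q (\<i> / 2)"
      unfolding Q_def using \<open>a > 0\<close> by (intro prod_mono) auto
    then show ?thesis by simp
  qed
  ultimately have "F0 * (1 + a / 2) ^ K \<le> 1"
    using \<open>F0 > 0\<close> unfolding F0_def by (meson mult_left_mono order_trans less_imp_le)
  then show False
    using K \<open>F0 > 0\<close> by (simp add: field_simps)
qed

section \<open>Determinants and Cramer's rule\<close>

text \<open>The determinant of the \<open>n \<times> n\<close> matrix with entries \<open>a i j\<close> for \<open>i, j < n\<close>. Matrices are given by their
  entry functions since the size \<open>n\<close> is a number obtained inside a proof.\<close>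

definition detf :: "nat \<Rightarrow> (nat \<Rightarrow> nat \<Rightarrow> complex) \<Rightarrow> complex"
  where "detf n a = Determinant.det (Matrix.mat n n (\<lambda>(i, j). a i j))"

lemma detf_eq_sum:
  "detf n a = (\<Sum>p | p permutes {0..<n}. signof p * (\<Prod>i = 0..<n. a i (p i)))"
  unfolding detf_def
  by (subst det_def'[where n = n]) (auto intro!: sum.cong prod.cong dest: permutes_in_image)

lemma holomorphic_on_detf:
  assumes "\<And>i j. i < n \<Longrightarrow> j < n \<Longrightarrow> (\<lambda>z. a z i j) holomorphic_on S"
  shows "(\<lambda>z. detf n (a z)) holomorphic_on S"
  unfolding detf_eq_sum
  by (intro holomorphic_intros assms) (auto dest: permutes_in_image)

lemma norm_det_le:
  fixes A :: "complex Matrix.mat"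
  assumes A: "A \<in> carrier_mat n n"
    and le: "\<And>i j. i < n \<Longrightarrow> j < n \<Longrightarrow> cmod (A $$ (i, j)) \<le> \<beta>"
  shows "cmod (Determinant.det A) \<le> fact n * \<beta> ^ n"
proof -
  have "cmod (Determinant.det A)
      \<le> (\<Sum>p | p permutes {0..<n}. cmod (signof p * (\<Prod>i = 0..<n. A $$ (i, p i))))"
    unfolding det_def'[OF A] by (rule norm_sum)
  also have "\<dots> \<le> (\<Sum>p | p permutes {0..<n}. \<beta> ^ n)"
  proof (rule sum_mono)
    fix p assume p: "p \<in> {p. p permutes {0..<n}}"
    have "cmod (signof p * (\<Prod>i = 0..<n. A $$ (i, p i))) = (\<Prod>i = 0..<n. cmod (A $$ (i, p i)))"
      by (simp add: norm_mult sign_def prod_norm)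
    also have "\<dots> \<le> (\<Prod>i = 0..<n. \<beta>)"
      using p by (intro prod_mono) (auto intro!: le dest: permutes_in_image)
    finally show "cmod (signof p * (\<Prod>i = 0..<n. A $$ (i, p i))) \<le> \<beta> ^ n"
      by simp
  qed
  also have "\<dots> = fact n * \<beta> ^ n"
    by (simp add: card_permutations)
  finally show ?thesis .
qed

lemma norm_detf_le:
  assumes "\<And>i j. i < n \<Longrightarrow> j < n \<Longrightarrow> cmod (a i j) \<le> \<beta>"
  shows "cmod (detf n a) \<le> fact n * \<beta> ^ n"
  unfolding detf_def by (rule norm_det_le) (use assms in auto)

lemma detf_nonzero:
  assumes inj: "\<And>c. (\<And>i. i < n \<Longrightarrow> (\<Sum>j<n. a i j * c j) = 0) \<Longrightarrow> (\<And>i. i < n \<Longrightarrow> c i = 0)"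
  shows "detf n a \<noteq> 0"
proof
  let ?A = "Matrix.mat n n (\<lambda>(i, j). a i j)"
  assume "detf n a = 0"
  then obtain v where v: "v \<in> carrier_vec n" "v \<noteq> 0\<^sub>v n" "?A *\<^sub>v v = 0\<^sub>v n"
    unfolding detf_def using det_0_iff_vec_prod_zero_field[of ?A n] by auto
  have "(\<Sum>j<n. a i j * Matrix.vec_index v j) = 0" if "i < n" for i
  proof -
    have "Matrix.vec_index (?A *\<^sub>v v) i = 0"
      using v(3) that by simp
    then show ?thesis
      using that v(1) by (simp add: scalar_prod_def atLeast0LessThan)
  qed
  then have "Matrix.vec_index v i = 0" if "i < n" for i
    using inj that by blast
  then have "v = 0\<^sub>v n"
    using v(1) by (intro eq_vecI) auto
  with v(2) show False by simp
qed

text \<open>A quantitative form of Cramer's rule.\<close>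

lemma Cramer_bound:
  assumes le: "\<And>i j. i < n \<Longrightarrow> j < n \<Longrightarrow> cmod (a i j) \<le> \<beta>" and "\<beta> \<ge> 1"
    and eq: "\<And>i. i < n \<Longrightarrow> (\<Sum>j<n. a i j * c j) = y i"
    and y: "\<And>i. i < n \<Longrightarrow> cmod (y i) \<le> Y"
    and i: "i < n"
  shows "cmod (detf n a) * cmod (c i) \<le> real n * (fact n * \<beta> ^ n * Y)"
proof -
  let ?A = "Matrix.mat n n (\<lambda>(i, j). a i j)"
  have A: "?A \<in> carrier_mat n n" by simp
  have cof: "cmod (cofactor ?A k l) \<le> fact n * \<beta> ^ n" if "k < n" "l < n" for k l
  proof -
    have "cmod (Determinant.det (mat_delete ?A k l)) \<le> fact (n - 1) * \<beta> ^ (n - 1)"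
      by (rule norm_det_le[OF mat_delete_carrier[OF A]]) (use that in \<open>auto simp: mat_delete_def intro!: le\<close>)
    also have "\<dots> \<le> fact n * \<beta> ^ n"
      using \<open>\<beta> \<ge> 1\<close> by (intro mult_mono power_increasing fact_mono) auto
    finally show ?thesis
      by (simp add: cofactor_def norm_mult norm_power)
  qed
  define v where "v = Matrix.vec n c"
  have v: "v \<in> carrier_vec n" by (simp add: v_def)
  have Av: "?A *\<^sub>v v = Matrix.vec n y"
    by (rule eq_vecI) (auto simp: v_def scalar_prod_def eq[symmetric] atLeast0LessThan)
  have "adj_mat ?A *\<^sub>v (?A *\<^sub>v v) = (adj_mat ?A * ?A) *\<^sub>v v"
    by (rule assoc_mult_mat_vec[OF adj_mat(1)[OF A] A v, symmetric])
  also have "\<dots> = detf n a \<cdot>\<^sub>v v"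
    unfolding adj_mat(3)[OF A] using v
    by (intro eq_vecI) (auto simp: detf_def scalar_prod_def if_distrib[of "\<lambda>x. _ * x"] if_distrib[of "\<lambda>x. x * _"] cong: if_cong)
  finally have "detf n a * c i = Matrix.vec_index (adj_mat ?A *\<^sub>v Matrix.vec n y) i"
    using Av i by (simp add: v_def)
  also have "\<dots> = (\<Sum>k<n. cofactor ?A k i * y k)"
    using i by (simp add: adj_mat_def scalar_prod_def atLeast0LessThan)
  finally have "cmod (detf n a) * cmod (c i) = cmod (\<Sum>k<n. cofactor ?A k i * y k)"
    by (metis norm_mult)
  also have "\<dots> \<le> (\<Sum>k<n. fact n * \<beta> ^ n * Y)"
    using \<open>\<beta> \<ge> 1\<close> by (intro sum_norm_le) (auto simp: norm_mult intro!: mult_mono cof y i)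
  finally show ?thesis by simp
qed

section \<open>Orthonormal systems\<close>

lemma cinner_zero_left [simp]: "cinner 0 (y::'a::complex_inner) = 0"
  using cinner_add_left[of 0 0 y] by simp

lemma cinner_minus_left: "cinner (- x) (y::'a::complex_inner) = - cinner x y"
  using cinner_add_left[of "- x" x y] by (simp add: eq_neg_iff_add_eq_0)

lemma cinner_diff_left: "cinner (x - z) (y::'a::complex_inner) = cinner x y - cinner z y"
  using cinner_add_left[of x "- z" y] by (simp add: cinner_minus_left)

lemma cinner_sum_left: "cinner (\<Sum>i\<in>A. f i) (y::'a::complex_inner) = (\<Sum>i\<in>A. cinner (f i) y)"
  by (induction A rule: infinite_finite_induct) (simp_all add: cinner_add_left)

lemma cinner_scaleC_right: "cinner x (c *\<^sub>C (y::'a::complex_inner)) = cnj c * cinner x y"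
  by (metis cinner_commute cinner_scaleC_left complex_cnj_mult)

lemma cinner_self: "cinner x (x::'a::complex_inner) = of_real ((norm x)\<^sup>2)"
proof -
  have "Im (cinner x x) = 0"
    using arg_cong[OF cinner_commute[of x x], of Im] by simp
  moreover have "Re (cinner x x) = (norm x)\<^sup>2"
    by (simp add: norm_eq_sqrt_cinner cinner_ge_zero)
  ultimately show ?thesis
    by (simp add: complex_eq_iff)
qed

text \<open>The Cauchy-Schwarz inequality with a unit vector.\<close>

lemma norm_cinner_le:
  fixes x e :: "'a::complex_inner"
  assumes e: "cinner e e = 1"
  shows "cmod (cinner x e) \<le> norm x"
proof -
  define c where "c = cinner x e"
  have "cinner e x = cnj c" by (simp add: c_def cinner_commute[of e])
  have "cinner (x - c *\<^sub>C e) e = 0"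
    by (simp add: cinner_diff_left cinner_scaleC_left e c_def)
  then have "cinner e (x - c *\<^sub>C e) = 0"
    by (metis cinner_commute complex_cnj_zero)
  then have "cinner (x - c *\<^sub>C e) (x - c *\<^sub>C e) = cinner x (x - c *\<^sub>C e)"
    by (simp add: cinner_diff_left cinner_scaleC_left)
  also have "\<dots> = cnj (cinner (x - c *\<^sub>C e) x)"
    by (rule cinner_commute)
  also have "\<dots> = of_real ((norm x)\<^sup>2 - (cmod c)\<^sup>2)"
    by (simp add: cinner_diff_left cinner_scaleC_left \<open>cinner e x = cnj c\<close> cinner_self
        complex_norm_square[of c, unfolded of_real_power])
  finally have "Re (of_real ((norm x)\<^sup>2 - (cmod c)\<^sup>2)) \<ge> 0"
    using cinner_ge_zero by metis
  then have "(cmod c)\<^sup>2 \<le> (norm x)\<^sup>2" by simp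
  then show ?thesis
    unfolding c_def by (rule power2_le_imp_le) simp
qed

text \<open>Gram-Schmidt orthonormalisation, in the form of the expansion of the vectors of the span.\<close>

lemma orthonormal_expansion_exists:
  fixes b :: "'a::complex_inner set"
  assumes "finite b"
  shows "\<exists>n (e::nat \<Rightarrow> 'a). (\<forall>i<n. \<forall>j<n. cinner (e i) (e j) = (if i = j then 1 else 0)) \<and>
    (\<forall>v\<in>cspan b. (\<Sum>i<n. cinner v (e i) *\<^sub>C e i) = v)"
proof -
  have "\<exists>n (e::nat \<Rightarrow> 'a). (\<forall>i<n. \<forall>j<n. cinner (e i) (e j) = (if i = j then 1 else 0)) \<and>
    (\<forall>v\<in>b. (\<Sum>i<n. cinner v (e i) *\<^sub>C e i) = v)"
    using assms
  proof (induction b rule: finite_induct)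
    case empty
    then show ?case by (intro exI[of _ 0]) simp
  next
    case (insert a b)
    then obtain n and e :: "nat \<Rightarrow> 'a"
      where on: "\<And>i j. i < n \<Longrightarrow> j < n \<Longrightarrow> cinner (e i) (e j) = (if i = j then 1 else 0)"
        and ex: "\<And>v. v \<in> b \<Longrightarrow> (\<Sum>i<n. cinner v (e i) *\<^sub>C e i) = v"
      by blast
    define r where "r = a - (\<Sum>i<n. cinner a (e i) *\<^sub>C e i)"
    show ?case
    proof (cases "r = 0")
      case True
      then show ?thesis
        using on ex by (intro exI[of _ n] exI[of _ e]) (auto simp: r_def)
    next
      case False
      define u where "u = complex_of_real (inverse (norm r)) *\<^sub>C r"
      define e' where "e' = e(n := u)"
      have r_orth: "cinner r (e j) = 0" if "j < n" for j
      proof -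
        have "cinner r (e j) = cinner a (e j) - (\<Sum>i<n. cinner a (e i) * cinner (e i) (e j))"
          by (simp add: r_def cinner_diff_left cinner_sum_left cinner_scaleC_left)
        also have "(\<Sum>i<n. cinner a (e i) * cinner (e i) (e j))
            = (\<Sum>i<n. if i = j then cinner a (e j) else 0)"
          using that by (intro sum.cong) (auto simp: on)
        finally show ?thesis using that by simp
      qed
      have ur_orth: "cinner u (e j) = 0" if "j < n" for j
        using r_orth[OF that] by (simp add: u_def cinner_scaleC_left)
      have eu_orth: "cinner (e j) u = 0" if "j < n" for j
        using ur_orth[OF that] by (subst cinner_commute) simp
      have "norm u = 1"
        using False by (simp add: u_def norm_scaleC norm_inverse)
      then have u_unit: "cinner u u = 1"
        by (simp add: cinner_self)
      have e'_lt: "e' i = e i" if "i < n" for i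
        using that by (simp add: e'_def)
      have e'_n: "e' n = u" by (simp add: e'_def)
      have split: "(\<Sum>i<Suc n. cinner v (e' i) *\<^sub>C e' i)
          = (\<Sum>i<n. cinner v (e i) *\<^sub>C e i) + cinner v u *\<^sub>C u" for v
        by (simp add: e'_n e'_lt)
      have sum_orth: "cinner (\<Sum>i<n. f i *\<^sub>C e i) u = 0" for f
        by (simp add: cinner_sum_left cinner_scaleC_left eu_orth)
      show ?thesis
      proof (intro exI[of _ "Suc n"] exI[of _ e'] conjI allI impI ballI)
        fix i j assume "i < Suc n" "j < Suc n"
        then show "cinner (e' i) (e' j) = (if i = j then 1 else 0)"
          by (auto simp: less_Suc_eq e'_lt e'_n on ur_orth eu_orth u_unit)
      next
        fix v assume "v \<in> insert a b"
        then show "(\<Sum>i<Suc n. cinner v (e' i) *\<^sub>C e' i) = v"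
        proof
          assume "v = a"
          have "cinner a u = cinner r u"
            using sum_orth by (simp add: r_def cinner_diff_left)
          also have "\<dots> = of_real (norm r)"
            using False by (simp add: u_def cinner_scaleC_right cinner_self power2_eq_square)
          finally have "cinner a u *\<^sub>C u = r"
            using False by (simp add: u_def)
          then show ?thesis
            unfolding split \<open>v = a\<close> by (simp add: r_def)
        next
          assume "v \<in> b"
          have "cinner v u = 0"
            using sum_orth[of "\<lambda>i. cinner v (e i)"] unfolding ex[OF \<open>v \<in> b\<close>] .
          then show ?thesis
            unfolding split ex[OF \<open>v \<in> b\<close>] by simp
        qed
      qed
    qed
  qed
  then obtain n and e :: "nat \<Rightarrow> 'a"
    where on: "\<forall>i<n. \<forall>j<n. cinner (e i) (e j) = (if i = j then 1 else 0)"
      and ex: "\<forall>v\<in>b. (\<Sum>i<n. cinner v (e i) *\<^sub>C e i) = v"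
    by blast
  have "(\<Sum>i<n. cinner v (e i) *\<^sub>C e i) = v" if "v \<in> cspan b" for v
    using that
  proof (rule complex_vector.span_induct)
    have scale: "(\<Sum>i<n. cinner (c *\<^sub>C x) (e i) *\<^sub>C e i) = c *\<^sub>C (\<Sum>i<n. cinner x (e i) *\<^sub>C e i)" for c x
      by (simp add: cinner_scaleC_left complex_vector.scale_sum_right)
    show "csubspace {v. (\<Sum>i<n. cinner v (e i) *\<^sub>C e i) = v}"
      by (rule complex_vector.subspaceI)
        (simp_all add: scale cinner_add_left scaleC_add_left sum.distrib)
  qed (use ex in blast)
  with on show ?thesis by blast
qed

section \<open>Operators with range in a finite-dimensional space\<close>

text \<open>The matrix, in the orthonormal system \<open>e\<close>, of the compression of \<open>I + T\<close> to the span of \<open>e\<close>: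
  column \<open>j\<close> contains the coordinates of the image of \<open>e j\<close>.\<close>

definition compression :: "(nat \<Rightarrow> 'a::complex_inner) \<Rightarrow> ('a \<Rightarrow>\<^sub>L 'a) \<Rightarrow> nat \<Rightarrow> nat \<Rightarrow> complex"
  where "compression e T i j = (if i = j then 1 else 0) + cinner (T (e j)) (e i)"

text \<open>The second assumption says that the range of \<open>T\<close> lies in the span of \<open>e 0, \<dots>, e (n - 1)\<close>.\<close>

context
  fixes n :: nat and e :: "nat \<Rightarrow> 'a::complex_inner" and T :: "'a \<Rightarrow>\<^sub>L 'a"
  assumes orthonormal: "\<And>i j. i < n \<Longrightarrow> j < n \<Longrightarrow> cinner (e i) (e j) = (if i = j then 1 else 0)"
    and expansion: "\<And>x. (\<Sum>i<n. cinner (T x) (e i) *\<^sub>C e i) = T x"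
    and clinear: "bounded_clinear (blinfun_apply T)"
begin

lemma blinfun_apply_sum_scaleC: "T (\<Sum>i<n. c i *\<^sub>C e i) = (\<Sum>i<n. c i *\<^sub>C T (e i))"
  using clinear by (simp add: blinfun.sum_right bounded_clinear_def)

lemma cinner_apply_sum:
  "cinner (T (\<Sum>j<n. c j *\<^sub>C e j)) (e i) = (\<Sum>j<n. c j * cinner (T (e j)) (e i))"
  by (simp add: blinfun_apply_sum_scaleC cinner_sum_left cinner_scaleC_left)

lemma compression_mult:
  assumes "i < n"
  shows "(\<Sum>j<n. compression e T i j * c j) = c i + cinner (T (\<Sum>j<n. c j *\<^sub>C e j)) (e i)"
proof -
  have "(\<Sum>j<n. compression e T i j * c j)
      = (\<Sum>j<n. (if i = j then c i else 0) + c j * cinner (T (e j)) (e i))"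
    by (intro sum.cong) (auto simp: compression_def algebra_simps)
  also have "\<dots> = c i + (\<Sum>j<n. c j * cinner (T (e j)) (e i))"
    using assms by (simp add: sum.distrib)
  finally show ?thesis
    by (simp only: cinner_apply_sum)
qed

lemma cinner_sum_basis:
  assumes "i < n"
  shows "cinner (\<Sum>j<n. c j *\<^sub>C e j) (e i) = c i"
proof -
  have "cinner (\<Sum>j<n. c j *\<^sub>C e j) (e i) = (\<Sum>j<n. if j = i then c i else 0)"
    unfolding cinner_sum_left cinner_scaleC_left
    by (intro sum.cong) (use assms in \<open>auto simp: orthonormal\<close>)
  then show ?thesis using assms by simp
qed

lemma norm_basis: "i < n \<Longrightarrow> norm (e i) = 1"
  by (simp add: norm_eq_sqrt_cinner orthonormal)

lemma norm_cinner_basis_le: "i < n \<Longrightarrow> cmod (cinner x (e i)) \<le> norm x"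
  by (rule norm_cinner_le) (simp add: orthonormal)

lemma norm_compression_le:
  assumes "i < n" "j < n"
  shows "cmod (compression e T i j) \<le> 1 + norm T"
proof -
  have "cmod (cinner (T (e j)) (e i)) \<le> norm (T (e j))"
    by (rule norm_cinner_basis_le) fact
  also have "\<dots> \<le> norm T"
    using norm_blinfun[of T "e j"] assms by (simp add: norm_basis)
  finally have "cmod (cinner (T (e j)) (e i)) \<le> norm T" .
  moreover have "cmod (if i = j then 1 else 0) \<le> 1" by simp
  ultimately show ?thesis
    unfolding compression_def by (intro norm_triangle_le) linarith
qed

lemma detf_compression_nonzero:
  assumes inj: "\<And>x. x + T x = 0 \<Longrightarrow> x = 0"
  shows "detf n (compression e T) \<noteq> 0"
proof (rule detf_nonzero)
  fix c i
  assume c: "\<And>i. i < n \<Longrightarrow> (\<Sum>j<n. compression e T i j * c j) = 0" and i: "i < n"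
  define x where "x = (\<Sum>j<n. c j *\<^sub>C e j)"
  have coord: "cinner (T x) (e i) = - c i" if "i < n" for i
  proof -
    have "c i + cinner (T x) (e i) = (\<Sum>j<n. compression e T i j * c j)"
      unfolding x_def by (rule compression_mult[OF that, symmetric])
    also have "\<dots> = 0" by (rule c) fact
    finally have "c i + cinner (T x) (e i) = 0" .
    then show ?thesis using add_eq_0_iff by blast
  qed
  have "T x = (\<Sum>i<n. cinner (T x) (e i) *\<^sub>C e i)"
    by (simp only: expansion)
  also have "\<dots> = (\<Sum>i<n. - (c i *\<^sub>C e i))"
    by (intro sum.cong) (auto simp: coord)
  also have "\<dots> = - x"
    by (simp add: x_def sum_negf)
  finally have "x + T x = 0" by simp
  then have "x = 0" by (rule inj)
  then show "c i = 0"
    using cinner_sum_basis[OF i, of c] by (simp add: x_def)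
qed

text \<open>If \<open>y = x + T x\<close>, then the coordinates of \<open>T x\<close> solve the linear system with the compression as
  matrix and the coordinates of \<open>T y\<close> as right-hand side. Cramer's rule bounds \<open>T x\<close>, and thus
  \<open>x = y - T x\<close>, in terms of \<open>y\<close>.\<close>

lemma detf_compression_bound:
  "cmod (detf n (compression e T)) * norm x
    \<le> (1 + (real n)\<^sup>2) * fact n * (1 + norm T) ^ Suc n * norm (x + T x)"
proof -
  define \<beta> where "\<beta> = 1 + norm T"
  define y where "y = x + T x"
  define d where "d = cmod (detf n (compression e T))"
  have \<beta>: "\<beta> \<ge> 1" by (simp add: \<beta>_def)
  have coeff: "d * cmod (cinner (T x) (e i)) \<le> real n * (fact n * \<beta> ^ n * (\<beta> * norm y))" if "i < n" for i
    unfolding d_def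
  proof (rule Cramer_bound[where y = "\<lambda>i. cinner (T y) (e i)"])
    fix i assume "i < n"
    then show "(\<Sum>j<n. compression e T i j * cinner (T x) (e j)) = cinner (T y) (e i)"
      by (simp add: compression_mult expansion y_def blinfun.add_right cinner_add_left)
    have "cmod (cinner (T y) (e i)) \<le> norm (T y)"
      by (rule norm_cinner_basis_le) fact
    also have "\<dots> \<le> norm T * norm y" by (rule norm_blinfun)
    also have "\<dots> \<le> \<beta> * norm y" by (intro mult_right_mono) (auto simp: \<beta>_def)
    finally show "cmod (cinner (T y) (e i)) \<le> \<beta> * norm y" .
  qed (use that \<beta> norm_compression_le in \<open>auto simp: \<beta>_def\<close>)
  have "norm x \<le> norm y + norm (T x)"
    using norm_triangle_ineq4[of y "T x"] by (simp add: y_def)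
  also have "norm (T x) = norm (\<Sum>i<n. cinner (T x) (e i) *\<^sub>C e i)"
    by (simp only: expansion)
  also have "\<dots> \<le> (\<Sum>i<n. cmod (cinner (T x) (e i)))"
    by (intro sum_norm_le) (simp add: norm_scaleC norm_basis)
  finally have "d * norm x \<le> d * (norm y + (\<Sum>i<n. cmod (cinner (T x) (e i))))"
    by (intro mult_left_mono) (auto simp: d_def)
  also have "\<dots> = d * norm y + (\<Sum>i<n. d * cmod (cinner (T x) (e i)))"
    by (simp add: distrib_left sum_distrib_left)
  also have "\<dots> \<le> fact n * \<beta> ^ Suc n * norm y + (\<Sum>i<n. real n * (fact n * \<beta> ^ n * (\<beta> * norm y)))"
  proof (intro add_mono sum_mono mult_right_mono)
    have "d \<le> fact n * \<beta> ^ n"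
      unfolding d_def \<beta>_def by (rule norm_detf_le[OF norm_compression_le])
    also have "\<dots> \<le> fact n * \<beta> ^ Suc n"
      using \<beta> by (intro mult_left_mono power_increasing) auto
    finally show "d \<le> fact n * \<beta> ^ Suc n" .
  qed (use coeff in auto)
  also have "\<dots> = (1 + (real n)\<^sup>2) * fact n * \<beta> ^ Suc n * norm y"
    by (simp add: algebra_simps power2_eq_square)
  finally show ?thesis
    by (simp add: d_def \<beta>_def y_def)
qed

end

lemma norm_inverse_op_le:
  fixes A :: "'a::complex_normed_vector \<Rightarrow>\<^sub>L 'a"
  assumes inv: "boundedly_invertible A" and "K \<ge> 0"
    and le: "\<And>x. norm x \<le> K * norm (A x)"
  shows "norm (inverse_op A) \<le> K"
proof (rule norm_blinfun_bound[OF \<open>K \<ge> 0\<close>])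
  fix y
  have bij: "bij (blinfun_apply A)" and lin: "bounded_linear (Hilbert_Choice.inv (blinfun_apply A))"
    using inv by (auto simp: boundedly_invertible_def bounded_clinear_def)
  have "norm (Hilbert_Choice.inv (blinfun_apply A) y) \<le> K * norm y"
    using le[of "Hilbert_Choice.inv (blinfun_apply A) y"] bij by (simp add: bij_is_surj surj_f_inv_f)
  then show "norm (inverse_op A y) \<le> K * norm y"
    by (simp add: inverse_op_def bounded_linear_Blinfun_apply[OF lin])
qed

lemma boundedly_invertible_imp_inj:
  assumes "boundedly_invertible A" "blinfun_apply A x = 0"
  shows "x = 0"
proof -
  have "inj (blinfun_apply A)"
    using assms(1) by (simp add: boundedly_invertible_def bij_is_inj)
  from injD[OF this, of x 0] show ?thesis
    using assms(2) by (simp add: blinfun.zero_right)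
qed

lemma vholomorphic_on_imp_holomorphic_matrix_entry:
  fixes B :: "complex \<Rightarrow> ('a::complex_inner \<Rightarrow>\<^sub>L 'a)"
  assumes B: "B vholomorphic_on S" and v: "cinner v v = 1"
  shows "(\<lambda>z. cinner (B z u) v) holomorphic_on S"
  unfolding holomorphic_on_def field_differentiable_def
proof
  fix z assume "z \<in> S"
  then obtain D where D: "((\<lambda>w. inverse (w - z) *\<^sub>C (B w - B z)) \<longlongrightarrow> D) (at z within S)"
    using B by (auto simp: vholomorphic_on_def)
  have lin: "bounded_linear (\<lambda>T::'a \<Rightarrow>\<^sub>L 'a. cinner (T u) v)"
  proof (rule bounded_linear_intro[where K = "norm u"])
    fix T :: "'a \<Rightarrow>\<^sub>L 'a"
    show "norm (cinner (T u) v) \<le> norm T * norm u"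
      using norm_cinner_le[OF v, of "T u"] norm_blinfun[of T u] by linarith
  qed (simp_all add: blinfun.add_left cinner_add_left blinfun.scaleR_left scaleR_scaleC
      cinner_scaleC_left scaleC_complex_def scaleC_blinfun.rep_eq)
  have "((\<lambda>w. (cinner (B w u) v - cinner (B z u) v) / (w - z)) \<longlongrightarrow> cinner (D u) v) (at z within S)"
    using bounded_linear.tendsto[OF lin D]
    by (simp add: scaleC_blinfun.rep_eq blinfun.diff_left cinner_scaleC_left cinner_diff_left
        divide_inverse mult.commute)
  then show "\<exists>f'. ((\<lambda>z. cinner (B z u) v) has_field_derivative f') (at z within S)"
    by (auto simp: has_field_derivative_iff)
qed

section \<open>The bound for the inverse\<close>

theorem theorem3p1:
  fixes B :: "complex \<Rightarrow> ('h::chilbert_space \<Rightarrow>\<^sub>L 'h)"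
    and V :: "'h set"
    and \<alpha> C M :: real
  assumes "\<And>z. Im z \<ge> 0 \<Longrightarrow> bounded_clinear (blinfun_apply (B z))"
    and "B vholomorphic_on {z. Im z > 0}"
    and "\<alpha> \<ge> 0" and "C > 0" and "M \<ge> 0"
    and "\<And>z. Im z \<ge> 0 \<Longrightarrow>
           norm (B z) \<le> C * (1 + cmod z) powr M * exp (\<alpha> * Im z)"
    and "\<And>z. 0 < Im z \<Longrightarrow> Im z < 1 \<Longrightarrow> boundedly_invertible (id_blinfun + B z)"
    and "finite_dim_csubspace V"
    and "\<And>z. Im z \<ge> 0 \<Longrightarrow> range (blinfun_apply (B z)) \<subseteq> V"
  shows "\<forall>\<epsilon>>0. \<exists>C\<^sub>\<epsilon>>0. \<forall>x::real.
           norm (inverse_op (id_blinfun + B (complex_of_real x + \<i> / 2)))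
             \<le> C\<^sub>\<epsilon> * exp (\<epsilon> * \<bar>x\<bar>\<^sup>2)"
proof (intro allI impI)
  fix \<epsilon> :: real assume "\<epsilon> > 0"
  note clin = assms(1) and hol = assms(2) and growth = assms(6) and invertible = assms(7) and ran = assms(9)
  obtain b where b: "finite b" "V = cspan b"
    using assms(8) by (auto simp: finite_dim_csubspace_def)
  obtain n and e :: "nat \<Rightarrow> 'h"
    where on_all: "\<forall>i<n. \<forall>j<n. cinner (e i) (e j) = (if i = j then 1 else 0)"
      and V: "\<forall>v\<in>V. (\<Sum>i<n. cinner v (e i) *\<^sub>C e i) = v"
    using orthonormal_expansion_exists[OF b(1)] unfolding b(2) by blast
  have on: "cinner (e i) (e j) = (if i = j then 1 else 0)" if "i < n" "j < n" for i j
    using on_all that by blast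
  have expansion: "(\<Sum>i<n. cinner (B z x) (e i) *\<^sub>C e i) = B z x" if "Im z \<ge> 0" for z x
    proof -
    have "B z x \<in> V" using ran[OF that] by blast
    then show ?thesis by (rule V[rule_format])
  qed
  define m where "m = nat \<lceil>M\<rceil>"
  define d where "d = (\<lambda>z. detf n (compression e (B z)))"
  \<comment> \<open>A majorant of \<open>1 + norm (B z)\<close> that is the modulus of a holomorphic function up to a constant, since
      \<open>z + \<i>\<close> has no zero in the half-plane.\<close>
  define \<gamma> where "\<gamma> = (\<lambda>z. (1 + C) * 2 ^ m * cmod (z + \<i>) ^ m * exp (\<alpha> * Im z))"
  define D where "D = fact n * ((1 + C) * 2 ^ m) ^ n"
  define F where "F = (\<lambda>z. d z * exp (\<i> * of_real (\<alpha> * real n) * z) / ((z + \<i>) ^ (m * n) * of_real D))"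
  have "D > 0" using \<open>C > 0\<close> by (simp add: D_def)
  have shift_ge: "1 \<le> cmod (z + \<i>)" if "Im z \<ge> 0" for z
    using abs_Im_le_cmod[of "z + \<i>"] that by simp
  have norm_le: "1 + norm (B z) \<le> \<gamma> z" if "Im z \<ge> 0" for z
  proof -
    have "cmod z \<le> cmod (z + \<i>)"
    proof (rule power2_le_imp_le)
      show "(cmod z)\<^sup>2 \<le> (cmod (z + \<i>))\<^sup>2"
        unfolding cmod_power2 using that by (simp add: power2_eq_square algebra_simps)
    qed simp
    then have z1: "1 + cmod z \<le> 2 * cmod (z + \<i>)"
      using shift_ge[OF that] by linarith
    have "M \<le> real m"
      unfolding m_def by (rule real_nat_ceiling_ge)
    then have "(1 + cmod z) powr M \<le> (1 + cmod z) powr real m"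
      by (intro powr_mono) auto
    also have "\<dots> = (1 + cmod z) ^ m"
      by (intro powr_realpow) (simp add: add_pos_nonneg)
    also have "\<dots> \<le> (2 * cmod (z + \<i>)) ^ m"
      using z1 by (intro power_mono) auto
    finally have "C * (1 + cmod z) powr M * exp (\<alpha> * Im z) \<le> C * (2 * cmod (z + \<i>)) ^ m * exp (\<alpha> * Im z)"
      using \<open>C > 0\<close> by (intro mult_right_mono mult_left_mono) auto
    then have "norm (B z) \<le> C * ((2 * cmod (z + \<i>)) ^ m * exp (\<alpha> * Im z))"
      using growth[OF that] by (simp only: mult.assoc)
    moreover have "1 \<le> (2 * cmod (z + \<i>)) ^ m * exp (\<alpha> * Im z)"
    proof -
      have "1 \<le> (2 * cmod (z + \<i>)) ^ m"
        using shift_ge[OF that] by (intro one_le_power) auto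
      moreover have "1 \<le> exp (\<alpha> * Im z)"
        using that \<open>\<alpha> \<ge> 0\<close> by simp
      ultimately show ?thesis
        using mult_mono[of 1 "(2 * cmod (z + \<i>)) ^ m" 1 "exp (\<alpha> * Im z)"] by simp
    qed
    ultimately have "1 + norm (B z) \<le> (1 + C) * ((2 * cmod (z + \<i>)) ^ m * exp (\<alpha> * Im z))"
      by (simp add: distrib_right)
    then show ?thesis
      by (simp add: \<gamma>_def power_mult_distrib mult.assoc)
  qed
  have norm_F: "cmod (F z) = cmod (d z) * exp (- (\<alpha> * real n * Im z)) / (cmod (z + \<i>) ^ (m * n) * D)" for z
    using \<open>D > 0\<close> by (simp add: F_def norm_mult norm_divide norm_power)
  have unit: "cinner (e i) (e i) = 1" if "i < n" for i
    using on[OF that that] by simp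
  have F_le: "cmod (F z) \<le> 1" if "Im z > 0" for z
  proof -
    have z: "Im z \<ge> 0" using that by simp
    have "cmod (compression e (B z) i j) \<le> 1 + norm (B z)" if "i < n" "j < n" for i j
      using that by (intro norm_compression_le[of n] on expansion clin z)
    then have "cmod (d z) \<le> fact n * (1 + norm (B z)) ^ n"
      unfolding d_def by (rule norm_detf_le)
    also have "\<dots> \<le> fact n * \<gamma> z ^ n"
      using norm_le[OF z] by (intro mult_left_mono power_mono) auto
    also have "\<dots> = D * cmod (z + \<i>) ^ (m * n) * exp (\<alpha> * real n * Im z)"
      by (simp add: \<gamma>_def D_def power_mult_distrib power_mult exp_of_nat_mult[symmetric] mult_ac)
    finally have "cmod (d z) * exp (- (\<alpha> * real n * Im z))
        \<le> D * cmod (z + \<i>) ^ (m * n) * exp (\<alpha> * real n * Im z) * exp (- (\<alpha> * real n * Im z))"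
      by (rule mult_right_mono) simp
    also have "\<dots> = cmod (z + \<i>) ^ (m * n) * D"
      by (simp add: mult.assoc exp_add[symmetric])
    finally have le: "cmod (d z) * exp (- (\<alpha> * real n * Im z)) \<le> cmod (z + \<i>) ^ (m * n) * D" .
    have "0 < cmod (z + \<i>) ^ (m * n) * D"
      using shift_ge[OF z] \<open>D > 0\<close> by (intro mult_pos_pos zero_less_power) auto
    with le show ?thesis
      unfolding norm_F by (simp only: pos_divide_le_eq mult_1_left)
  qed
  have d_nz: "d z \<noteq> 0" if "0 < Im z" "Im z < 1" for z
    unfolding d_def
  proof (rule detf_compression_nonzero[OF on])
    show "bounded_clinear (blinfun_apply (B z))" using that by (intro clin) simp
    show "(\<Sum>i<n. cinner (B z x) (e i) *\<^sub>C e i) = B z x" for x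
      using that by (intro expansion) simp
    show "x = 0" if "x + B z x = 0" for x
      using boundedly_invertible_imp_inj[OF invertible[OF \<open>0 < Im z\<close> \<open>Im z < 1\<close>], of x] that
      by (simp add: plus_blinfun.rep_eq)
  qed
  have "(\<lambda>z. compression e (B z) i j) holomorphic_on {z. Im z > 0}" if "i < n" "j < n" for i j
    unfolding compression_def
    using vholomorphic_on_imp_holomorphic_matrix_entry[OF hol unit[OF that(1)]]
    by (intro holomorphic_intros)
  then have "d holomorphic_on {z. Im z > 0}"
    unfolding d_def by (rule holomorphic_on_detf)
  moreover have "z + \<i> \<noteq> 0" if "Im z > 0" for z
    using shift_ge[of z] that by auto
  ultimately have F_hol: "F holomorphic_on {z. Im z > 0}"
    unfolding F_def using \<open>D > 0\<close> by (intro holomorphic_intros) auto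
  have F_nz: "F z \<noteq> 0" if "0 < Im z" "Im z < 1" for z
    using d_nz[OF that] shift_ge[of z] that \<open>D > 0\<close> by (auto simp: F_def)
  obtain c where "c > 0"
    and lower: "\<And>x. c * exp (- (\<epsilon> / 2 * x\<^sup>2)) \<le> cmod (F (complex_of_real x + \<i> / 2))"
    using nonvanishing_strip_lower_bound[OF F_hol F_le F_nz, of "\<epsilon> / 2"] \<open>\<epsilon> > 0\<close> by auto
  define N where "N = (1 + (real n)\<^sup>2) * fact n"
  define p where "p = real (m * Suc n)"
  define G where "G = ((1 + C) * 2 ^ m * exp (real m) * exp (\<alpha> / 2)) ^ Suc n"
  define K where "K = N * G * exp (p\<^sup>2 / (2 * \<epsilon>)) / (D * c)"
  have "N > 0" by (simp add: N_def add_pos_nonneg)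
  have "G > 0" using \<open>C > 0\<close> by (simp add: G_def)
  have "K > 0" using \<open>N > 0\<close> \<open>G > 0\<close> \<open>D > 0\<close> \<open>c > 0\<close> by (simp add: K_def)
  have "norm (inverse_op (id_blinfun + B (complex_of_real x + \<i> / 2))) \<le> K * exp (\<epsilon> * \<bar>x\<bar>\<^sup>2)" for x
  proof -
    define z where "z = complex_of_real x + \<i> / 2"
    have Im_z: "Im z = 1 / 2" by (simp add: z_def)
    have "cmod (F z) \<le> cmod (d z) / D"
    proof -
      have "cmod (d z) * exp (- (\<alpha> * real n * Im z)) \<le> cmod (d z) * 1"
        using \<open>\<alpha> \<ge> 0\<close> Im_z by (intro mult_left_mono) auto
      moreover have "1 * D \<le> cmod (z + \<i>) ^ (m * n) * D"
        using shift_ge[of z] Im_z \<open>D > 0\<close> by (intro mult_right_mono one_le_power) auto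
      ultimately show ?thesis
        unfolding norm_F using \<open>D > 0\<close> by (intro frac_le) auto
    qed
    then have "c * exp (- (\<epsilon> / 2 * x\<^sup>2)) \<le> cmod (d z) / D"
      using lower[of x] unfolding z_def by linarith
    then have d_ge: "D * c * exp (- (\<epsilon> / 2 * x\<^sup>2)) \<le> cmod (d z)"
      using \<open>D > 0\<close> by (simp add: pos_le_divide_eq mult_ac)
    have "cmod (z + \<i>) \<le> 2 + \<bar>x\<bar>"
      using cmod_le[of "z + \<i>"] by (simp add: z_def)
    also have "\<dots> \<le> exp (1 + \<bar>x\<bar>)"
      using exp_ge_add_one_self[of "1 + \<bar>x\<bar>"] by simp
    finally have "cmod (z + \<i>) ^ m \<le> exp (1 + \<bar>x\<bar>) ^ m"
      by (intro power_mono) auto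
    then have "\<gamma> z \<le> (1 + C) * 2 ^ m * exp (1 + \<bar>x\<bar>) ^ m * exp (\<alpha> / 2)"
      unfolding \<gamma>_def using \<open>C > 0\<close> by (simp add: Im_z)
    also have "\<dots> = (1 + C) * 2 ^ m * exp (real m) * exp (\<alpha> / 2) * exp (real m * \<bar>x\<bar>)"
      unfolding exp_add power_mult_distrib by (simp add: exp_of_nat_mult[symmetric] mult_ac)
    finally have "1 + norm (B z) \<le> (1 + C) * 2 ^ m * exp (real m) * exp (\<alpha> / 2) * exp (real m * \<bar>x\<bar>)"
      using norm_le[of z] Im_z by simp
    then have "(1 + norm (B z)) ^ Suc n \<le> ((1 + C) * 2 ^ m * exp (real m) * exp (\<alpha> / 2) * exp (real m * \<bar>x\<bar>)) ^ Suc n"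
      by (intro power_mono) auto
    also have "\<dots> = G * exp (p * \<bar>x\<bar>)"
    proof -
      have "exp (real m * \<bar>x\<bar>) ^ Suc n = exp (real (Suc n) * (real m * \<bar>x\<bar>))"
        by (rule exp_of_nat_mult[symmetric])
      also have "real (Suc n) * (real m * \<bar>x\<bar>) = p * \<bar>x\<bar>"
        by (simp add: p_def algebra_simps)
      finally show ?thesis
        unfolding G_def power_mult_distrib[of _ "exp (real m * \<bar>x\<bar>)"] by (simp only:)
    qed
    \<comment> \<open>Polynomial growth is traded for \<open>exp (p * \<bar>x\<bar>)\<close>, which half of the Gaussian absorbs.\<close>
    also have "\<dots> \<le> G * exp (p\<^sup>2 / (2 * \<epsilon>) + \<epsilon> / 2 * x\<^sup>2)"
    proof -
      have "0 \<le> (\<epsilon> * \<bar>x\<bar> - p)\<^sup>2" by simp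
      also have "\<dots> = \<epsilon>\<^sup>2 * x\<^sup>2 + p\<^sup>2 - p * \<bar>x\<bar> * (2 * \<epsilon>)"
        by (simp add: power2_diff power_mult_distrib)
      finally have "p * \<bar>x\<bar> \<le> (\<epsilon>\<^sup>2 * x\<^sup>2 + p\<^sup>2) / (2 * \<epsilon>)"
        using \<open>\<epsilon> > 0\<close> by (simp add: pos_le_divide_eq)
      also have "\<dots> = p\<^sup>2 / (2 * \<epsilon>) + \<epsilon> / 2 * x\<^sup>2"
        using \<open>\<epsilon> > 0\<close> by (simp add: add_divide_distrib power2_eq_square)
      finally show ?thesis
        using \<open>G > 0\<close> by simp
    qed
    finally have T_le: "(1 + norm (B z)) ^ Suc n \<le> G * exp (p\<^sup>2 / (2 * \<epsilon>)) * exp (\<epsilon> / 2 * x\<^sup>2)"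
      by (simp add: exp_add mult.assoc)
    have "norm y \<le> K * exp (\<epsilon> * \<bar>x\<bar>\<^sup>2) * norm ((id_blinfun + B z) y)" for y
    proof -
      define E where "E = exp (\<epsilon> / 2 * x\<^sup>2)"
      define r where "r = norm (y + B z y)"
      have "E > 0" "r \<ge> 0" by (auto simp: E_def r_def)
      have "D * c * exp (- (\<epsilon> / 2 * x\<^sup>2)) * norm y \<le> cmod (d z) * norm y"
        using d_ge by (rule mult_right_mono) simp
      also have "\<dots> \<le> N * (1 + norm (B z)) ^ Suc n * r"
        unfolding d_def N_def r_def
        by (rule detf_compression_bound[OF on]) (auto intro: expansion clin simp: Im_z)
      also have "\<dots> \<le> N * (G * exp (p\<^sup>2 / (2 * \<epsilon>)) * E) * r"
        using T_le \<open>N > 0\<close> \<open>r \<ge> 0\<close> unfolding E_def by (intro mult_right_mono mult_left_mono) auto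
      also have "exp (- (\<epsilon> / 2 * x\<^sup>2)) = 1 / E"
        unfolding E_def exp_minus by (rule inverse_eq_divide)
      finally have "D * c * norm y / E \<le> N * G * exp (p\<^sup>2 / (2 * \<epsilon>)) * E * r"
        by (simp add: mult.assoc)
      then have "D * c * norm y \<le> N * G * exp (p\<^sup>2 / (2 * \<epsilon>)) * E * r * E"
        using \<open>E > 0\<close> by (simp only: pos_divide_le_eq)
      then have "norm y \<le> N * G * exp (p\<^sup>2 / (2 * \<epsilon>)) * E * r * E / (D * c)"
        using \<open>D > 0\<close> \<open>c > 0\<close> by (simp add: pos_le_divide_eq mult_ac)
      also have "\<dots> = K * (E * E) * r"
        by (simp add: K_def)
      also have "E * E = exp (\<epsilon> * \<bar>x\<bar>\<^sup>2)"
        unfolding E_def exp_add[symmetric] by simp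
      finally show ?thesis
        by (simp add: r_def plus_blinfun.rep_eq)
    qed
    then show ?thesis
      unfolding z_def[symmetric] using \<open>K > 0\<close> Im_z
      by (intro norm_inverse_op_le[OF invertible]) auto
  qed
  then show "\<exists>C\<^sub>\<epsilon>>0. \<forall>x::real. norm (inverse_op (id_blinfun + B (complex_of_real x + \<i> / 2)))
      \<le> C\<^sub>\<epsilon> * exp (\<epsilon> * \<bar>x\<bar>\<^sup>2)"
    using \<open>K > 0\<close> by blast
qed

end
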